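(* Let $m$ be a positive even integer, let $s\ge 1$, let $a_1,\dots,a_s\ge 0$ be integers, and put $a=\sum_{i=1}^s(a_i+1)$. For each $i$ let $c_i\in\tfrac12\mathbb{Z}$ with $c_i-a_i/2\in\mathbb{Z}$, and let $A_i=\{c_i-a_i/2,\,c_i-a_i/2+1,\,\dots,\,c_i+a_i/2\}$ (the $a_i+1$ consecutive integers centered at $c_i$). Assume that $A_1,\dots,A_s$ are pairwise disjoint subsets of $\{1,2,\dots,m+a\}$. For an integer $k$ with $0\le k\le\min_i a_i$, let $G_k$ be the graph obtained from $AR_{m+k,\,m+k+a}$ by deleting, for each $i=1,\dots,s$, all cells of the copy of $O_{k,\,a_i-k}$ centered at $(m+k,\;k+2c_i-1)$. (In particular $G_0$ is $AR_{m,m+a}$ with the cells $(m,2t-1)$, $t\in A_1\cup\dots\cup A_s$, deleted.) Then for every integer $k$ with $1\le k\le \min_i a_i$, $$\mathrm{M}(G_k)=2^{\binom{k+1}{2}(s+1)+km}\,\mathrm{M}(G_0).$$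
   Context: For integers $M,N\ge 0$ let $B_{M,N}=\{0,1,\dots,2M\}\times\{0,1,\dots,2N\}$; an element $(i,j)$ (row $i$, column $j$) is a cell, black if $i+j$ is even and white if $i+j$ is odd. The Aztec rectangle graph $AR_{M,N}$ has as vertices the white cells of $B_{M,N}$, two cells $(i,j),(i',j')$ being adjacent iff $|i-i'|=|j-j'|=1$ (its perfect matchings correspond to domino tilings of the Aztec rectangle region). For integers $K,L\ge0$ and $(x,y)\in\mathbb{Z}^2$ with $x+y+K+L$ odd, the copy of the odd Aztec rectangle $O_{K,L}$ centered at $(x,y)$ is the set of cells $\{(x+r,y+t): r,t\in\mathbb{Z},\ |r|\le K,\ |t|\le L,\ r+t\equiv K+L \pmod 2\}$; all of its cells are white. Deleting cells means taking the induced subgraph on the remaining vertices. $\mathrm{M}(G)$ denotes the number of perfect matchings of a graph $G$ (equivalently, the number of domino tilings of the dual region). In the paper the right-hand side is also expressed as the number of perfect matchings of the graph $R(m,m+a;\cdot)$, which is $G_0$. *)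

theory Defs
  imports Complex_Main "HOL-Library.Disjoint_Sets"
begin

text \<open>A graph is a pair of a vertex set and a set of edges, each edge being a two-element set
  of vertices.\<close>

type_synonym 'a graph = "'a set \<times> 'a set set"

definition delete_vertices :: "'a graph \<Rightarrow> 'a set \<Rightarrow> 'a graph" where
  "delete_vertices G D = (fst G - D, {e \<in> snd G. e \<subseteq> fst G - D})"

definition perfect_matching :: "'a graph \<Rightarrow> 'a set set \<Rightarrow> bool" where
  "perfect_matching G F \<longleftrightarrow> F \<subseteq> snd G \<and> (\<forall>v \<in> fst G. \<exists>!e. e \<in> F \<and> v \<in> e)"

definition num_perfect_matchings :: "'a graph \<Rightarrow> nat" where
  "num_perfect_matchings G = card {F. perfect_matching G F}"

type_synonym cell = "int \<times> int"

definition board :: "nat \<Rightarrow> nat \<Rightarrow> cell set" where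
  "board M N = {0..2 * int M} \<times> {0..2 * int N}"

definition white :: "cell \<Rightarrow> bool" where
  "white p \<longleftrightarrow> odd (fst p + snd p)"

definition cell_adjacent :: "cell \<Rightarrow> cell \<Rightarrow> bool" where
  "cell_adjacent p q \<longleftrightarrow> \<bar>fst p - fst q\<bar> = 1 \<and> \<bar>snd p - snd q\<bar> = 1"

definition aztec_rectangle_vertices :: "nat \<Rightarrow> nat \<Rightarrow> cell set" where
  "aztec_rectangle_vertices M N = {p \<in> board M N. white p}"

definition aztec_rectangle :: "nat \<Rightarrow> nat \<Rightarrow> cell graph" where
  "aztec_rectangle M N =
     (aztec_rectangle_vertices M N,
      {{p, q} | p q. p \<in> aztec_rectangle_vertices M N \<and> q \<in> aztec_rectangle_vertices M N
                     \<and> cell_adjacent p q})"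

definition odd_aztec_rectangle :: "nat \<Rightarrow> nat \<Rightarrow> cell \<Rightarrow> cell set" where
  "odd_aztec_rectangle K L z =
     {(fst z + r, snd z + t) | r t.
        \<bar>r\<bar> \<le> int K \<and> \<bar>t\<bar> \<le> int L \<and> (r + t) mod 2 = (int K + int L) mod 2}"

text \<open>The integers from \<open>x - n/2\<close> to \<open>x + n/2\<close>: there are \<open>n + 1\<close> of them, centered at \<open>x\<close>,
  when \<open>x - n/2\<close> is an integer.\<close>

definition centered_interval :: "real \<Rightarrow> nat \<Rightarrow> int set" where
  "centered_interval x n = {t. x - real n / 2 \<le> real_of_int t \<and> real_of_int t \<le> x + real n / 2}"

text \<open>The centers \<open>c i\<close> are half-integers, so \<open>2 * c i\<close> is an integer and the floor below
  only converts its type.\<close>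

definition holey_aztec_rectangle ::
  "nat \<Rightarrow> nat \<Rightarrow> (nat \<Rightarrow> nat) \<Rightarrow> (nat \<Rightarrow> real) \<Rightarrow> nat \<Rightarrow> cell graph" where
  "holey_aztec_rectangle m s a c k =
     delete_vertices (aztec_rectangle (m + k) (m + k + (\<Sum>i=1..s. (a i + 1))))
       (\<Union>i\<in>{1..s}. odd_aztec_rectangle k (a i - k)
          (int m + int k, int k + \<lfloor>2 * c i\<rfloor> - 1))"

end

theory Submission
  imports Defs "HOL-Library.FuncSet" "HOL-Library.Product_Plus"
begin

text \<open>
  The proof is one application of Ciucu's complementation principle for each step from \<open>k\<close> to
  \<open>k - 1\<close>. The edges of \<open>G\<^sub>k\<close> split into 4-cycles around the black cells with odd coordinates. If
  \<open>w S\<close> is the number of ways to cover exactly the corner set \<open>S\<close> of a 4-cycle by disjoint edges of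
  it, then \<open>2 * w S = 2 ^ (card S div 2) * w (Q - S)\<close>, where \<open>Q\<close> is the set of all four corners.
  Replacing in every 4-cycle the covered corners by the uncovered ones keeps a vertex lying in two
  4-cycles covered exactly once, and toggles the presence of a vertex lying in only one. For \<open>G\<^sub>k\<close>
  this peels off the outer boundary of the board, fills the top and bottom rows of every hole and
  widens the hole by one column on each side: up to translation the result is \<open>G\<^sub>k\<^sub>-\<^sub>1\<close>. Half the
  number of vertices minus the number of 4-cycles is \<open>m + k * (s + 1)\<close>.
\<close>

section \<open>Complementation in graphs composed of 4-cycles\<close>

definition four_cycle :: "'a graph \<Rightarrow> bool" where
  "four_cycle G \<longleftrightarrow> (\<exists>a b c d. distinct [a, b, c, d] \<and>
     G = ({a, b, c, d}, {{a, b}, {b, c}, {c, d}, {d, a}}))"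

text \<open>The edge set and the covered set are kept apart so that one fixed \<open>E\<close> can
  serve several vertex sets, as complementation requires.\<close>

definition matchings_covering :: "'a set set \<Rightarrow> 'a set \<Rightarrow> 'a set set set" where
  "matchings_covering E S = {F. F \<subseteq> E \<and> disjoint F \<and> \<Union>F = S}"

text \<open>Uniqueness of the edge at each vertex is pairwise disjointness. Restricting to edges
  inside \<open>V\<close> costs nothing, since a family with union \<open>V\<close> has no
  others.\<close>

lemma perfect_matching_iff_matchings_covering:
  "perfect_matching (V, {e \<in> E. e \<subseteq> V}) F \<longleftrightarrow> F \<in> matchings_covering E V"
proof
  assume "perfect_matching (V, {e \<in> E. e \<subseteq> V}) F"
  then have sub: "F \<subseteq> {e \<in> E. e \<subseteq> V}" and ex: "\<forall>v\<in>V. \<exists>!e. e \<in> F \<and> v \<in> e"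
    by (auto simp: perfect_matching_def)
  have "disjoint F"
    using sub ex by (fastforce simp: disjoint_def)
  moreover have "\<Union>F = V"
    using sub ex by blast
  ultimately show "F \<in> matchings_covering E V"
    using sub by (auto simp: matchings_covering_def)
next
  assume "F \<in> matchings_covering E V"
  then have "F \<subseteq> E" "disjoint F" "\<Union>F = V"
    by (auto simp: matchings_covering_def)
  moreover from this have "\<exists>!e. e \<in> F \<and> v \<in> e" if "v \<in> V" for v
    using that unfolding disjoint_def by (metis Union_iff disjoint_iff)
  ultimately show "perfect_matching (V, {e \<in> E. e \<subseteq> V}) F"
    unfolding perfect_matching_def by auto
qed

lemma num_perfect_matchings_eq_card_matchings_covering:
  "num_perfect_matchings (V, {e \<in> E. e \<subseteq> V}) = card (matchings_covering E V)"
  by (simp add: num_perfect_matchings_def perfect_matching_iff_matchings_covering)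

lemma finite_matchings_covering: "finite E \<Longrightarrow> finite (matchings_covering E S)"
  by (rule finite_subset[of _ "Pow E"]) (auto simp: matchings_covering_def)

section \<open>Matchings of a single 4-cycle\<close>

text \<open>Of the 16 sets of edges, exactly these seven contain no two edges with a common
  corner.\<close>

lemma matchings_covering_four_cycle:
  assumes "distinct [a, b, c, d]"
  shows "matchings_covering {{a, b}, {b, c}, {c, d}, {d, a}} S =
    {F \<in> {{}, {{a, b}}, {{b, c}}, {{c, d}}, {{d, a}}, {{a, b}, {c, d}}, {{b, c}, {d, a}}}. \<Union>F = S}"
proof -
  have "F \<in> {{}, {{a, b}}, {{b, c}}, {{c, d}}, {{d, a}}, {{a, b}, {c, d}}, {{b, c}, {d, a}}}"
    if F: "F \<subseteq> {{a, b}, {b, c}, {c, d}, {d, a}}" "disjoint F" for F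
  proof -
    have nd: "\<not> ({a, b} \<in> F \<and> {b, c} \<in> F)" "\<not> ({b, c} \<in> F \<and> {c, d} \<in> F)"
      "\<not> ({c, d} \<in> F \<and> {d, a} \<in> F)" "\<not> ({d, a} \<in> F \<and> {a, b} \<in> F)"
      using F(2) assms unfolding disjoint_def by (fastforce simp: doubleton_eq_iff)+
    have "F \<in> Pow {{a, b}, {b, c}, {c, d}, {d, a}}"
      using F(1) by simp
    then show ?thesis
      using nd unfolding Pow_insert Pow_empty image_insert image_empty
        Un_insert_left Un_insert_right Un_empty_left Un_empty_right
      by (elim insertE emptyE) simp_all
  qed
  moreover have "disjoint F" "F \<subseteq> {{a, b}, {b, c}, {c, d}, {d, a}}"
    if "F \<in> {{}, {{a, b}}, {{b, c}}, {{c, d}}, {{d, a}}, {{a, b}, {c, d}}, {{b, c}, {d, a}}}" for F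
    using that assms by (auto simp: disjoint_def)
  ultimately have iff:
    "F \<in> {{}, {{a, b}}, {{b, c}}, {{c, d}}, {{d, a}}, {{a, b}, {c, d}}, {{b, c}, {d, a}}} \<longleftrightarrow>
      F \<subseteq> {{a, b}, {b, c}, {c, d}, {d, a}} \<and> disjoint F" for F
    by (intro iffI conjI) simp_all
  show ?thesis
    unfolding matchings_covering_def iff conj_assoc ..
qed

text \<open>The empty matching and each single edge are the only ones covering their corner set,
  while the two pairs of opposite edges cover the same full set, hence the factor 2. Odd sets and
  diagonal pairs are not covered at all.\<close>

lemma card_matchings_covering_four_cycle:
  assumes d: "distinct [a, b, c, d]" and S: "S \<subseteq> {a, b, c, d}"
  shows "card (matchings_covering {{a, b}, {b, c}, {c, d}, {d, a}} S) =
    of_bool (a \<notin> S \<and> b \<notin> S \<and> c \<notin> S \<and> d \<notin> S) +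
    of_bool (a \<in> S \<and> b \<in> S \<and> c \<notin> S \<and> d \<notin> S) +
    of_bool (a \<notin> S \<and> b \<in> S \<and> c \<in> S \<and> d \<notin> S) +
    of_bool (a \<notin> S \<and> b \<notin> S \<and> c \<in> S \<and> d \<in> S) +
    of_bool (a \<in> S \<and> b \<notin> S \<and> c \<notin> S \<and> d \<in> S) +
    2 * of_bool (a \<in> S \<and> b \<in> S \<and> c \<in> S \<and> d \<in> S)"
proof -
  let ?X = "{{}, {{a, b}}, {{b, c}}, {{c, d}}, {{d, a}}, {{a, b}, {c, d}}, {{b, c}, {d, a}}}"
  have ne: "a \<noteq> b" "a \<noteq> c" "a \<noteq> d" "b \<noteq> c" "b \<noteq> d" "c \<noteq> d"
    "b \<noteq> a" "c \<noteq> a" "d \<noteq> a" "c \<noteq> b" "d \<noteq> b" "d \<noteq> c"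
    using d by auto
  \<comment> \<open>Both sets consist of corners, so their equality reduces to four membership tests
    that the simplifier can evaluate.\<close>
  have eq: "\<Union>F = S \<longleftrightarrow>
      (\<forall>v\<in>{a, b, c, d}. v \<in> \<Union>F \<longleftrightarrow> v \<in> S)" if "F \<in> ?X" for F
  proof -
    have "\<Union>F \<subseteq> {a, b, c, d}"
      using that by auto
    with S show ?thesis by blast
  qed
  have "card (matchings_covering {{a, b}, {b, c}, {c, d}, {d, a}} S) = card {F \<in> ?X. \<Union>F = S}"
    using matchings_covering_four_cycle[OF d] by simp
  also have "\<dots> = (\<Sum>F\<in>?X. of_bool (\<Union>F = S))"
    by (subst sum_of_bool_eq) (simp_all only: Int_def mem_Collect_eq of_nat_id finite.intros)
  also have "\<dots> = (\<Sum>F\<in>?X. of_bool (\<forall>v\<in>{a, b, c, d}. v \<in> \<Union>F \<longleftrightarrow> v \<in> S))"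
    by (rule sum.cong[OF refl]) (simp only: eq)
  also have "\<dots> = of_bool (a \<notin> S \<and> b \<notin> S \<and> c \<notin> S \<and> d \<notin> S) +
    of_bool (a \<in> S \<and> b \<in> S \<and> c \<notin> S \<and> d \<notin> S) +
    of_bool (a \<notin> S \<and> b \<in> S \<and> c \<in> S \<and> d \<notin> S) +
    of_bool (a \<notin> S \<and> b \<notin> S \<and> c \<in> S \<and> d \<in> S) +
    of_bool (a \<in> S \<and> b \<notin> S \<and> c \<notin> S \<and> d \<in> S) +
    2 * of_bool (a \<in> S \<and> b \<in> S \<and> c \<in> S \<and> d \<in> S)"
    by (simp add: ne doubleton_eq_iff)
  finally show ?thesis .
qed

text \<open>The counts are 1 for the empty set and for two adjacent corners, 2 for all corners, 0
  otherwise; the nonzero cases read \<open>2 * 1 = 1 * 2\<close>, \<open>2 * 1 = 2 * 1\<close> and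
  \<open>2 * 2 = 4 * 1\<close>. Evenness later lets the halved sizes be added up without
  loss.\<close>

lemma card_matchings_covering_four_cycle_compl:
  assumes "four_cycle (Q, E)" "S \<subseteq> Q"
  shows "2 * card (matchings_covering E S) =
    2 ^ (card S div 2) * card (matchings_covering E (Q - S))"
    and "card (matchings_covering E S) \<noteq> 0 \<Longrightarrow> even (card S)"
proof -
  obtain a b c d where d: "distinct [a, b, c, d]" and
    Q: "Q = {a, b, c, d}" and E: "E = {{a, b}, {b, c}, {c, d}, {d, a}}"
    using assms(1) by (auto simp: four_cycle_def)
  have "card S = (\<Sum>v\<in>Q. of_bool (v \<in> S))"
    using assms(2) Q by (subst sum_of_bool_eq) (auto intro: arg_cong[of _ _ card])
  also have "\<dots> = of_bool (a \<in> S) + of_bool (b \<in> S) + of_bool (c \<in> S) + of_bool (d \<in> S)"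
    using d unfolding Q by simp
  finally have S: "card S =
    of_bool (a \<in> S) + of_bool (b \<in> S) + of_bool (c \<in> S) + of_bool (d \<in> S)" .
  have 1: "card (matchings_covering E S) =
    of_bool (a \<notin> S \<and> b \<notin> S \<and> c \<notin> S \<and> d \<notin> S) +
    of_bool (a \<in> S \<and> b \<in> S \<and> c \<notin> S \<and> d \<notin> S) +
    of_bool (a \<notin> S \<and> b \<in> S \<and> c \<in> S \<and> d \<notin> S) +
    of_bool (a \<notin> S \<and> b \<notin> S \<and> c \<in> S \<and> d \<in> S) +
    of_bool (a \<in> S \<and> b \<notin> S \<and> c \<notin> S \<and> d \<in> S) +
    2 * of_bool (a \<in> S \<and> b \<in> S \<and> c \<in> S \<and> d \<in> S)"
    using card_matchings_covering_four_cycle[OF d] assms(2) unfolding Q E by blast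
  have 2: "card (matchings_covering E (Q - S)) =
    of_bool (a \<in> S \<and> b \<in> S \<and> c \<in> S \<and> d \<in> S) +
    of_bool (a \<notin> S \<and> b \<notin> S \<and> c \<in> S \<and> d \<in> S) +
    of_bool (a \<in> S \<and> b \<notin> S \<and> c \<notin> S \<and> d \<in> S) +
    of_bool (a \<in> S \<and> b \<in> S \<and> c \<notin> S \<and> d \<notin> S) +
    of_bool (a \<notin> S \<and> b \<in> S \<and> c \<in> S \<and> d \<notin> S) +
    2 * of_bool (a \<notin> S \<and> b \<notin> S \<and> c \<notin> S \<and> d \<notin> S)"
    using card_matchings_covering_four_cycle[OF d, of "Q - S"] unfolding Q E by simp
  show "2 * card (matchings_covering E S) =
    2 ^ (card S div 2) * card (matchings_covering E (Q - S))"
    unfolding 1 2 S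
    by (cases "a \<in> S"; cases "b \<in> S"; cases "c \<in> S"; cases "d \<in> S") simp_all
  show "even (card S)" if "card (matchings_covering E S) \<noteq> 0"
    using that unfolding 1 S
    by (cases "a \<in> S"; cases "b \<in> S"; cases "c \<in> S"; cases "d \<in> S") simp_all
qed

section \<open>Splitting matchings along edge-disjoint 4-cycles\<close>

text \<open>Asking for exact multiplicities at each vertex, rather than for disjointness and a
  union, turns complementation into a subtraction of numbers.\<close>

definition cell_covers :: "'i set \<Rightarrow> ('i \<Rightarrow> 'a set) \<Rightarrow> 'a set \<Rightarrow> ('i \<Rightarrow> 'a set) set" where
  "cell_covers C Q V =
     {S \<in> PiE C (\<lambda>z. Pow (Q z)). \<forall>v. card {z \<in> C. v \<in> S z} = of_bool (v \<in> V)}"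

lemma card_eq_of_bool_iff:
  assumes "finite C"
  shows "(\<forall>v. card {z \<in> C. v \<in> S z} = of_bool (v \<in> V)) \<longleftrightarrow>
    disjoint_family_on S C \<and> (\<Union>z\<in>C. S z) = V"
proof
  assume A: "\<forall>v. card {z \<in> C. v \<in> S z} = of_bool (v \<in> V)"
  have "z = z'" if z: "z \<in> C" "z' \<in> C" "v \<in> S z" "v \<in> S z'" for z z' v
  proof -
    have "card {z \<in> C. v \<in> S z} \<le> 1"
      using A by simp
    then show ?thesis
      using z assms by (auto simp: card_le_Suc0_iff_eq)
  qed
  moreover have "v \<in> V \<longleftrightarrow> (\<exists>z\<in>C. v \<in> S z)" for v
  proof -
    have "v \<in> V \<longleftrightarrow> card {z \<in> C. v \<in> S z} \<noteq> 0"
      using A by simp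
    then show ?thesis
      using assms by auto
  qed
  ultimately show "disjoint_family_on S C \<and> (\<Union>z\<in>C. S z) = V"
    unfolding disjoint_family_on_def by blast
next
  assume A: "disjoint_family_on S C \<and> (\<Union>z\<in>C. S z) = V"
  show "\<forall>v. card {z \<in> C. v \<in> S z} = of_bool (v \<in> V)"
  proof
    fix v
    show "card {z \<in> C. v \<in> S z} = of_bool (v \<in> V)"
    proof (cases "v \<in> V")
      case True
      then obtain z where "z \<in> C" "v \<in> S z"
        using A by auto
      then have "{z \<in> C. v \<in> S z} = {z}"
        using A unfolding disjoint_family_on_def by blast
      then show ?thesis
        using True by simp
    next
      case False
      then have empty: "{z \<in> C. v \<in> S z} = {}"
        using A by auto
      show ?thesis
        unfolding empty using False by simp
    qed
  qed
qed

text \<open>Since the sets \<open>E z\<close> are disjoint, a matching is the same as the family of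
  its restrictions to them. The families are grouped by the corner set \<open>S z\<close> that each
  restriction covers.\<close>

lemma matchings_covering_split:
  assumes "finite C" and "\<And>z. z \<in> C \<Longrightarrow> \<Union>(E z) \<subseteq> Q z" and "disjoint_family_on E C"
  shows "bij_betw (\<lambda>F. \<lambda>z\<in>C. F \<inter> E z) (matchings_covering (\<Union>z\<in>C. E z) V)
    (\<Union>S\<in>cell_covers C Q V. PiE C (\<lambda>z. matchings_covering (E z) (S z)))"
proof (rule bij_betw_byWitness[where f' = "\<lambda>g. \<Union>z\<in>C. g z"])
  let ?M = "matchings_covering (\<Union>z\<in>C. E z) V"
  let ?B = "\<Union>S\<in>cell_covers C Q V. PiE C (\<lambda>z. matchings_covering (E z) (S z))"
  show "\<forall>F\<in>?M. (\<Union>z\<in>C. (\<lambda>z\<in>C. F \<inter> E z) z) = F"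
    by (auto simp: matchings_covering_def)
  have gE: "g z \<subseteq> E z" if "g \<in> ?B" "z \<in> C" for g z
    using that by (auto simp: PiE_iff matchings_covering_def)
  have restr: "(\<Union>z\<in>C. g z) \<inter> E z = g z" if "g \<in> ?B" "z \<in> C" for g z
  proof -
    have "z' = z" if "z' \<in> C" "e \<in> g z'" "e \<in> E z" for z' e
      using gE[OF \<open>g \<in> ?B\<close> that(1)] that \<open>z \<in> C\<close> assms(3)
      unfolding disjoint_family_on_def by blast
    then show ?thesis
      using gE[OF that] that(2) by blast
  qed
  show "\<forall>g\<in>?B. (\<lambda>z\<in>C. (\<Union>z\<in>C. g z) \<inter> E z) = g"
  proof
    fix g assume g: "g \<in> ?B"
    then have "g \<in> extensional C"
      by (auto simp: PiE_def)
    then show "(\<lambda>z\<in>C. (\<Union>z\<in>C. g z) \<inter> E z) = g"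
      using restr[OF g] by (intro extensionalityI[of _ C]) auto
  qed
  show "(\<lambda>F. \<lambda>z\<in>C. F \<inter> E z) ` ?M \<subseteq> ?B"
  proof
    fix g assume "g \<in> (\<lambda>F. \<lambda>z\<in>C. F \<inter> E z) ` ?M"
    then obtain F where g: "g = (\<lambda>z\<in>C. F \<inter> E z)" and F: "F \<subseteq> (\<Union>z\<in>C. E z)" "disjoint F" "\<Union>F = V"
      by (auto simp: matchings_covering_def)
    \<comment> \<open>The corners that \<open>F\<close> covers through edges of the 4-cycle
      \<open>z\<close>.\<close>
    define S where "S = (\<lambda>z\<in>C. \<Union>(F \<inter> E z))"
    have "z = z'" if z: "z \<in> C" "z' \<in> C" and v: "v \<in> S z" "v \<in> S z'" for z z' v
    proof -
      obtain e e' where e: "e \<in> F" "e \<in> E z" "v \<in> e" "e' \<in> F" "e' \<in> E z'" "v \<in> e'"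
        using z v by (auto simp: S_def)
      then have "e = e'"
        using F(2) unfolding disjoint_def by blast
      then show ?thesis
        using e z assms(3) unfolding disjoint_family_on_def by blast
    qed
    then have "disjoint_family_on S C"
      unfolding disjoint_family_on_def by blast
    moreover have "(\<Union>z\<in>C. S z) = V"
      using F by (fastforce simp: S_def)
    ultimately have "\<forall>v. card {z \<in> C. v \<in> S z} = of_bool (v \<in> V)"
      unfolding card_eq_of_bool_iff[OF assms(1)] by (rule conjI)
    moreover have "S \<in> PiE C (\<lambda>z. Pow (Q z))"
      using assms(2) unfolding S_def by (auto simp: PiE_iff)
    ultimately have "S \<in> cell_covers C Q V"
      by (simp add: cell_covers_def)
    moreover have "g \<in> PiE C (\<lambda>z. matchings_covering (E z) (S z))"
      using F(2) by (auto simp: g S_def matchings_covering_def disjoint_def)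
    ultimately show "g \<in> ?B" by blast
  qed
  show "(\<lambda>g. \<Union>z\<in>C. g z) ` ?B \<subseteq> ?M"
  proof
    fix F assume "F \<in> (\<lambda>g. \<Union>z\<in>C. g z) ` ?B"
    then obtain g S where F: "F = (\<Union>z\<in>C. g z)" and S: "S \<in> cell_covers C Q V"
      and g: "g \<in> PiE C (\<lambda>z. matchings_covering (E z) (S z))"
      by blast
    have S': "disjoint_family_on S C" "(\<Union>z\<in>C. S z) = V"
      using S unfolding cell_covers_def card_eq_of_bool_iff[OF assms(1)] by simp_all
    have g': "g z \<subseteq> E z" "disjoint (g z)" "\<Union>(g z) = S z" if "z \<in> C" for z
      using g that by (auto simp: PiE_iff matchings_covering_def)
    \<comment> \<open>A common vertex lies in \<open>S z\<close> and \<open>S z'\<close>, so both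
      edges come from one 4-cycle, where \<open>g z\<close> is already a matching.\<close>
    have "e = e'" if e: "e \<in> F" "e' \<in> F" "v \<in> e" "v \<in> e'" for e e' v
    proof -
      obtain z z' where z: "z \<in> C" "z' \<in> C" "e \<in> g z" "e' \<in> g z'"
        using e F by auto
      then have "v \<in> S z" "v \<in> S z'"
        using e g'(3) by blast+
      then have "z = z'"
        using z S'(1) unfolding disjoint_family_on_def by blast
      then show ?thesis
        using z e g'(2)[of z] unfolding disjoint_def by blast
    qed
    then have "disjoint F"
      unfolding disjoint_def by blast
    moreover have "\<Union>F = V"
    proof -
      have "\<Union>F = (\<Union>z\<in>C. \<Union>(g z))"
        unfolding F by blast
      then show ?thesis
        using g'(3) S'(2) by simp
    qed
    ultimately show "F \<in> ?M"
      using g'(1) F by (auto simp: matchings_covering_def)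
  qed
qed

lemma card_matchings_covering_split:
  assumes "finite C" and "\<And>z. z \<in> C \<Longrightarrow> finite (Q z)" and "\<And>z. z \<in> C \<Longrightarrow> finite (E z)"
    and "\<And>z. z \<in> C \<Longrightarrow> \<Union>(E z) \<subseteq> Q z" and "disjoint_family_on E C"
  shows "card (matchings_covering (\<Union>z\<in>C. E z) V) =
    (\<Sum>S\<in>cell_covers C Q V. \<Prod>z\<in>C. card (matchings_covering (E z) (S z)))"
proof -
  let ?P = "\<lambda>S. PiE C (\<lambda>z. matchings_covering (E z) (S z))"
  have fin: "finite (cell_covers C Q V)"
    unfolding cell_covers_def using assms(1,2) by (simp add: finite_PiE)
  have "card (matchings_covering (\<Union>z\<in>C. E z) V) = card (\<Union>S\<in>cell_covers C Q V. ?P S)"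
    using matchings_covering_split[OF assms(1,4,5)] by (rule bij_betw_same_card)
  also have "\<dots> = (\<Sum>S\<in>cell_covers C Q V. card (?P S))"
  proof (rule card_UN_disjoint[OF fin])
    show "\<forall>S\<in>cell_covers C Q V. finite (?P S)"
      using assms(1,3) by (simp add: finite_PiE finite_matchings_covering)
    show "\<forall>S\<in>cell_covers C Q V. \<forall>S'\<in>cell_covers C Q V. S \<noteq> S' \<longrightarrow> ?P S \<inter> ?P S' = {}"
    proof (intro ballI impI)
      fix S S' assume S: "S \<in> cell_covers C Q V" "S' \<in> cell_covers C Q V" "S \<noteq> S'"
      \<comment> \<open>A family \<open>g\<close> determines \<open>S\<close>, because
        \<open>S z\<close> is the union of \<open>g z\<close>.\<close>
      have "S = S'" if "g \<in> ?P S" "g \<in> ?P S'" for g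
      proof (rule PiE_ext)
        show "S \<in> PiE C (\<lambda>z. Pow (Q z))" "S' \<in> PiE C (\<lambda>z. Pow (Q z))"
          using S by (auto simp: cell_covers_def)
        show "S z = S' z" if "z \<in> C" for z
          using \<open>g \<in> ?P S\<close> \<open>g \<in> ?P S'\<close> that by (auto simp: PiE_iff matchings_covering_def)
      qed
      with S(3) show "?P S \<inter> ?P S' = {}" by blast
    qed
  qed
  also have "\<dots> = (\<Sum>S\<in>cell_covers C Q V. \<Prod>z\<in>C. card (matchings_covering (E z) (S z)))"
    using assms(1) by (simp add: card_PiE)
  finally show ?thesis .
qed

text \<open>At each vertex the multiplicity of the complements is the number of 4-cycles through it
  minus its multiplicity in \<open>S\<close>, and subtracting the indicator of \<open>V\<close>
  leaves that of \<open>V'\<close>.\<close>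

lemma cell_covers_compl:
  assumes "finite C" "S \<in> cell_covers C Q V"
    and "\<And>v. card {z \<in> C. v \<in> Q z} = of_bool (v \<in> V) + of_bool (v \<in> V')"
  shows "(\<lambda>z\<in>C. Q z - S z) \<in> cell_covers C Q V'"
proof -
  have sub: "S z \<subseteq> Q z" if "z \<in> C" for z
    using assms(2) that by (auto simp: cell_covers_def PiE_iff)
  have "card {z \<in> C. v \<in> (\<lambda>z\<in>C. Q z - S z) z} = of_bool (v \<in> V')" for v
  proof -
    have "{z \<in> C. v \<in> (\<lambda>z\<in>C. Q z - S z) z} = {z \<in> C. v \<in> Q z} - {z \<in> C. v \<in> S z}"
      by auto
    moreover have "{z \<in> C. v \<in> S z} \<subseteq> {z \<in> C. v \<in> Q z}"
      using sub by auto
    ultimately have "card {z \<in> C. v \<in> (\<lambda>z\<in>C. Q z - S z) z} =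
        card {z \<in> C. v \<in> Q z} - card {z \<in> C. v \<in> S z}"
      using assms(1) by (simp add: card_Diff_subset)
    then show ?thesis
      using assms(2,3) by (simp add: cell_covers_def)
  qed
  moreover have "(\<lambda>z\<in>C. Q z - S z) \<in> PiE C (\<lambda>z. Pow (Q z))"
    by auto
  ultimately show ?thesis
    unfolding cell_covers_def by blast
qed

lemma cell_covers_double_compl:
  assumes "S \<in> cell_covers C Q V"
  shows "(\<lambda>z\<in>C. Q z - (\<lambda>z\<in>C. Q z - S z) z) = S"
proof (rule PiE_ext)
  show "(\<lambda>z\<in>C. Q z - (\<lambda>z\<in>C. Q z - S z) z) \<in> PiE C (\<lambda>z. Pow (Q z))"
    by auto
  show S: "S \<in> PiE C (\<lambda>z. Pow (Q z))"
    using assms by (simp add: cell_covers_def)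
  show "(\<lambda>z\<in>C. Q z - (\<lambda>z\<in>C. Q z - S z) z) z = S z" if "z \<in> C" for z
    using S that by (auto simp: PiE_iff)
qed

text \<open>The identity for one 4-cycle is applied to every factor of every summand. The factors 2
  give \<open>2 ^ card C\<close>, and the halved sizes of the sets \<open>S z\<close> add up to half
  of \<open>card V\<close>.\<close>

lemma complementation:
  assumes "finite C" and cyc: "\<And>z. z \<in> C \<Longrightarrow> four_cycle (Q z, E z)"
    and "disjoint_family_on E C"
    and deg: "\<And>v. card {z \<in> C. v \<in> Q z} = of_bool (v \<in> V) + of_bool (v \<in> V')"
  shows "2 ^ card C * card (matchings_covering (\<Union>z\<in>C. E z) V) =
    2 ^ (card V div 2) * card (matchings_covering (\<Union>z\<in>C. E z) V')"
proof -
  let ?w = "\<lambda>z S. card (matchings_covering (E z) S)"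
  have fin: "finite (Q z)" "finite (E z)" "\<Union>(E z) \<subseteq> Q z" if "z \<in> C" for z
    using cyc[OF that] by (auto simp: four_cycle_def)
  note split = card_matchings_covering_split[OF assms(1) fin assms(3)]
  have deg': "card {z \<in> C. v \<in> Q z} = of_bool (v \<in> V') + of_bool (v \<in> V)" for v
    using deg by simp
  have "2 ^ card C * card (matchings_covering (\<Union>z\<in>C. E z) V) =
      (\<Sum>S\<in>cell_covers C Q V. 2 ^ card C * (\<Prod>z\<in>C. ?w z (S z)))"
    by (simp add: split sum_distrib_left)
  also have "\<dots> = (\<Sum>S\<in>cell_covers C Q V. 2 ^ (card V div 2) * (\<Prod>z\<in>C. ?w z (Q z - S z)))"
  proof (rule sum.cong[OF refl])
    fix S assume S: "S \<in> cell_covers C Q V"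
    have sub: "S z \<subseteq> Q z" if "z \<in> C" for z
      using S that by (auto simp: cell_covers_def PiE_iff)
    note w = card_matchings_covering_four_cycle_compl[OF cyc sub]
    have "2 ^ card C * (\<Prod>z\<in>C. ?w z (S z)) = (\<Prod>z\<in>C. 2 * ?w z (S z))"
      by (simp add: prod.distrib)
    also have "\<dots> = (\<Prod>z\<in>C. 2 ^ (card (S z) div 2) * ?w z (Q z - S z))"
      by (rule prod.cong[OF refl]) (simp only: w(1))
    also have "\<dots> = 2 ^ (\<Sum>z\<in>C. card (S z) div 2) * (\<Prod>z\<in>C. ?w z (Q z - S z))"
      by (simp add: prod.distrib power_sum)
    also have "\<dots> = 2 ^ (card V div 2) * (\<Prod>z\<in>C. ?w z (Q z - S z))"
    \<comment> \<open>A vanishing factor makes both sides zero. Otherwise every \<open>S z\<close>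
      has even size, so the integer divisions by 2 are exact and can be summed.\<close>
    proof (cases "\<exists>z\<in>C. ?w z (Q z - S z) = 0")
      case True
      then have "(\<Prod>z\<in>C. ?w z (Q z - S z)) = 0"
        using assms(1) by (simp add: prod_zero_iff)
      then show ?thesis by simp
    next
      case False
      have ev: "even (card (S z))" if "z \<in> C" for z
      proof -
        have "2 * ?w z (S z) \<noteq> 0"
          using w(1)[OF that that] False that by simp
        then show ?thesis
          using w(2)[OF that that] by simp
      qed
      have S': "disjoint_family_on S C" "(\<Union>z\<in>C. S z) = V"
        using S unfolding cell_covers_def card_eq_of_bool_iff[OF assms(1)] by simp_all
      have "card V = (\<Sum>z\<in>C. card (S z))"
        unfolding S'(2)[symmetric] using assms(1) fin(1) sub S'(1)
        by (intro card_UN_disjoint) (auto intro: finite_subset simp: disjoint_family_on_def)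
      also have "\<dots> = (\<Sum>z\<in>C. 2 * (card (S z) div 2))"
        using ev by simp
      finally have "card V div 2 = (\<Sum>z\<in>C. card (S z) div 2)"
        by (simp add: sum_distrib_left[symmetric])
      then show ?thesis by simp
    qed
    finally show "2 ^ card C * (\<Prod>z\<in>C. ?w z (S z)) =
      2 ^ (card V div 2) * (\<Prod>z\<in>C. ?w z (Q z - S z))" .
  qed
  also have "\<dots> = 2 ^ (card V div 2) * (\<Sum>S\<in>cell_covers C Q V. \<Prod>z\<in>C. ?w z (Q z - S z))"
    by (simp add: sum_distrib_left)
  also have "(\<Sum>S\<in>cell_covers C Q V. \<Prod>z\<in>C. ?w z (Q z - S z)) =
      (\<Sum>S\<in>cell_covers C Q V'. \<Prod>z\<in>C. ?w z (S z))"
  \<comment> \<open>Complementing in every 4-cycle is its own inverse and exchanges covers of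
    \<open>V\<close> with covers of \<open>V'\<close>.\<close>
  proof (rule sum.reindex_bij_witness)
    show "(\<lambda>z\<in>C. Q z - S z) \<in> cell_covers C Q V'" if "S \<in> cell_covers C Q V" for S
      using cell_covers_compl[OF assms(1) that deg] .
    show "(\<lambda>z\<in>C. Q z - S z) \<in> cell_covers C Q V" if "S \<in> cell_covers C Q V'" for S
      using cell_covers_compl[OF assms(1) that deg'] .
  qed (rule cell_covers_double_compl | simp)+
  also have "\<dots> = card (matchings_covering (\<Union>z\<in>C. E z) V')"
    by (simp add: split)
  finally show ?thesis .
qed

section \<open>Diagonal adjacency of cells\<close>

definition diagonal_graph :: "cell set \<Rightarrow> cell graph" where
  "diagonal_graph V = (V, {{p, q} | p q. p \<in> V \<and> q \<in> V \<and> cell_adjacent p q})"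

text \<open>Adjacency depends on the two cells alone, so every induced subgraph is again determined
  by its set of cells.\<close>

lemma delete_vertices_aztec_rectangle:
  "delete_vertices (aztec_rectangle M N) D = diagonal_graph (aztec_rectangle_vertices M N - D)"
proof -
  let ?V = "aztec_rectangle_vertices M N"
  have "{e \<in> {{p, q} | p q. p \<in> ?V \<and> q \<in> ?V \<and> cell_adjacent p q}. e \<subseteq> ?V - D} =
      {{p, q} | p q. p \<in> ?V - D \<and> q \<in> ?V - D \<and> cell_adjacent p q}" (is "?A = ?B")
  proof (intro set_eqI iffI)
    fix e assume "e \<in> ?A"
    then obtain p q where "e = {p, q}" "cell_adjacent p q" "e \<subseteq> ?V - D"
      by auto
    then have "e = {p, q} \<and> p \<in> ?V - D \<and> q \<in> ?V - D \<and> cell_adjacent p q"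
      by simp
    then show "e \<in> ?B" by blast
  next
    fix e assume "e \<in> ?B"
    then obtain p q where "e = {p, q}" "cell_adjacent p q" "p \<in> ?V - D" "q \<in> ?V - D"
      by auto
    then show "e \<in> ?A" by blast
  qed
  then show ?thesis
    by (simp add: delete_vertices_def aztec_rectangle_def diagonal_graph_def)
qed

text \<open>Unique existence becomes a property of a set, which can be carried along an injective
  image.\<close>

lemma ex1_iff_is_singleton: "(\<exists>!x. x \<in> A \<and> P x) \<longleftrightarrow> is_singleton {x \<in> A. P x}"
proof
  assume "\<exists>!x. x \<in> A \<and> P x"
  then obtain x where "{x \<in> A. P x} = {x}" by blast
  then show "is_singleton {x \<in> A. P x}" by simp
next
  assume "is_singleton {x \<in> A. P x}"
  then obtain x where "{x \<in> A. P x} = {x}"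
    by (rule is_singletonE)
  then show "\<exists>!x. x \<in> A \<and> P x"
    by (intro ex1I[of _ x]) blast+
qed

section \<open>Invariance under relabelling and translation\<close>

text \<open>An injection on vertices induces injections on edges and on sets of edges; the latter
  restricts to a bijection between perfect matchings.\<close>

lemma num_perfect_matchings_image:
  assumes "inj f"
  shows "num_perfect_matchings (f ` V, (\<lambda>e. f ` e) ` E) = num_perfect_matchings (V, E)"
proof -
  let ?g = "(`) ((`) f)"
  have inj1: "inj ((`) f)"
    by (rule injI) (simp add: inj_image_eq_iff[OF assms])
  have inj: "inj ?g"
    by (rule injI) (simp add: inj_image_eq_iff[OF inj1])
  have iff: "perfect_matching (f ` V, (`) f ` E) (?g F) \<longleftrightarrow> perfect_matching (V, E) F" for F
  proof -
    have ex: "(\<exists>!e. e \<in> ?g F \<and> f v \<in> e) \<longleftrightarrow> (\<exists>!e. e \<in> F \<and> v \<in> e)" for v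
    proof -
      have "{e \<in> ?g F. f v \<in> e} = ?g {e \<in> F. v \<in> e}"
        by (auto simp: inj_eq[OF assms])
      moreover have "is_singleton (?g A) \<longleftrightarrow> is_singleton A" for A
        by (simp add: is_singleton_altdef card_image inj_on_subset[OF inj1])
      ultimately show ?thesis
        unfolding ex1_iff_is_singleton by simp
    qed
    have "?g F \<subseteq> (`) f ` E \<longleftrightarrow> F \<subseteq> E"
      by (simp add: inj_image_subset_iff[OF inj1])
    then show ?thesis
      by (simp add: perfect_matching_def ex)
  qed
  have "{F. perfect_matching (f ` V, (`) f ` E) F} = ?g ` {F. perfect_matching (V, E) F}"
  proof (intro set_eqI iffI)
    fix F assume F: "F \<in> {F. perfect_matching (f ` V, (`) f ` E) F}"
    then obtain F' where "F = ?g F'"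
      by (auto simp: perfect_matching_def subset_image_iff)
    with F iff show "F \<in> ?g ` {F. perfect_matching (V, E) F}" by auto
  qed (use iff in auto)
  then show ?thesis
    unfolding num_perfect_matchings_def by (simp add: card_image inj_on_subset[OF inj])
qed

lemma num_perfect_matchings_translate:
  "num_perfect_matchings (diagonal_graph ((\<lambda>p. p + d) ` V)) = num_perfect_matchings (diagonal_graph V)"
proof -
  have "diagonal_graph ((\<lambda>p. p + d) ` V) =
      ((\<lambda>p. p + d) ` V, (\<lambda>e. (\<lambda>p. p + d) ` e) ` snd (diagonal_graph V))"
  proof -
    have "{{p, q} | p q. p \<in> (\<lambda>p. p + d) ` V \<and> q \<in> (\<lambda>p. p + d) ` V \<and> cell_adjacent p q} =
      {{p + d, q + d} | p q. p \<in> V \<and> q \<in> V \<and> cell_adjacent p q}"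
      by (fastforce simp: cell_adjacent_def)
    also have "\<dots> = (\<lambda>e. (\<lambda>p. p + d) ` e) ` {{p, q} | p q. p \<in> V \<and> q \<in> V \<and> cell_adjacent p q}"
    proof (intro set_eqI iffI)
      fix e assume "e \<in> {{p + d, q + d} | p q. p \<in> V \<and> q \<in> V \<and> cell_adjacent p q}"
      then obtain p q where "e = (\<lambda>p. p + d) ` {p, q}" "p \<in> V" "q \<in> V" "cell_adjacent p q"
        by auto
      then show "e \<in> (\<lambda>e. (\<lambda>p. p + d) ` e) ` {{p, q} | p q. p \<in> V \<and> q \<in> V \<and> cell_adjacent p q}"
        by blast
    qed (auto simp del: split_paired_Ex)
    finally show ?thesis
      by (simp add: diagonal_graph_def)
  qed
  then show ?thesis
    by (simp add: num_perfect_matchings_image diagonal_graph_def)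
qed

section \<open>The 4-cycles around black cells with odd coordinates\<close>

text \<open>The neighbours of \<open>z\<close> sharing a side with it, listed cyclically so that
  consecutive ones are diagonally adjacent.\<close>

definition cell_corners :: "cell \<Rightarrow> cell set" where
  "cell_corners z = (case z of (x, y) \<Rightarrow> {(x - 1, y), (x, y + 1), (x + 1, y), (x, y - 1)})"

definition cell_edges :: "cell \<Rightarrow> cell set set" where
  "cell_edges z = (case z of (x, y) \<Rightarrow>
     {{(x - 1, y), (x, y + 1)}, {(x, y + 1), (x + 1, y)}, {(x + 1, y), (x, y - 1)}, {(x, y - 1), (x - 1, y)}})"

lemma four_cycle_cell: "four_cycle (cell_corners z, cell_edges z)"
proof (cases z)
  case (Pair x y)
  show ?thesis
    unfolding four_cycle_def cell_corners_def cell_edges_def Pair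
    by (rule exI[of _ "(x - 1, y)"], rule exI[of _ "(x, y + 1)"], rule exI[of _ "(x + 1, y)"],
        rule exI[of _ "(x, y - 1)"]) simp
qed

text \<open>Two diagonally adjacent white cells span a 2 by 2 square with two black cells, one with
  odd and one with even coordinates. Using only the odd ones as centers assigns each edge to one
  4-cycle.\<close>

definition odd_cells :: "cell set" where
  "odd_cells = {(x, y). odd x \<and> odd y}"

lemma cell_edges_iff:
  "e \<in> cell_edges (x, y) \<longleftrightarrow>
    (\<exists>x' y'. e = {(x', y), (x, y')} \<and> \<bar>x - x'\<bar> = 1 \<and> \<bar>y - y'\<bar> = 1)"
  (is "_ \<longleftrightarrow> ?R")
proof
  show ?R if "e \<in> cell_edges (x, y)"
    using that by (force simp: cell_edges_def doubleton_eq_iff)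
  show "e \<in> cell_edges (x, y)" if R: ?R
  proof -
    obtain x' y' where e: "e = {(x', y), (x, y')}" "\<bar>x - x'\<bar> = 1" "\<bar>y - y'\<bar> = 1"
      using R by blast
    have "x' = x - 1 \<or> x' = x + 1" "y' = y - 1 \<or> y' = y + 1"
      using e by linarith+
    then show ?thesis
      unfolding e(1) cell_edges_def by (auto simp: insert_commute)
  qed
qed

text \<open>The two ends of an edge have rows of different parity: the end in the even row gives the
  column of the center, the end in the odd row gives its row.\<close>

lemma disjoint_family_on_cell_edges:
  assumes "C \<subseteq> odd_cells"
  shows "disjoint_family_on cell_edges C"
proof -
  have "z = z'" if z: "z \<in> C" "z' \<in> C" and e: "e \<in> cell_edges z" "e \<in> cell_edges z'" for e z z'
  proof -
    obtain x y x' y' where zz: "z = (x, y)" "z' = (x', y')"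
      by (cases z, cases z')
    have odd: "odd x" "odd y" "odd x'" "odd y'"
      using assms z by (auto simp: zz odd_cells_def)
    obtain a b where ab: "e = {(a, y), (x, b)}" "\<bar>x - a\<bar> = 1" "\<bar>y - b\<bar> = 1"
      using e(1) cell_edges_iff unfolding zz by auto
    obtain a' b' where ab': "e = {(a', y'), (x', b')}" "\<bar>x' - a'\<bar> = 1" "\<bar>y' - b'\<bar> = 1"
      using e(2) cell_edges_iff unfolding zz by auto
    have "even a" "even a'"
      using ab ab' odd by presburger+
    then show ?thesis
      using ab(1) ab'(1) odd by (auto simp: zz doubleton_eq_iff)
  qed
  then show ?thesis
    unfolding disjoint_family_on_def by blast
qed

text \<open>The center belonging to an edge takes its row from the end in the odd row and its column
  from the other end; for white cells both are odd.\<close>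

lemma diagonal_graph_eq_cell_edges:
  assumes "\<And>x y x' y'. (x, y) \<in> V \<Longrightarrow> (x', y') \<in> V \<Longrightarrow> even x \<Longrightarrow>
      \<bar>x - x'\<bar> = 1 \<Longrightarrow> \<bar>y - y'\<bar> = 1 \<Longrightarrow> (x', y) \<in> C"
  shows "diagonal_graph V = (V, {e \<in> (\<Union>z\<in>C. cell_edges z). e \<subseteq> V})"
proof -
  have "e \<in> snd (diagonal_graph V) \<longleftrightarrow> e \<in> (\<Union>z\<in>C. cell_edges z) \<and> e \<subseteq> V" for e
  proof
    assume "e \<in> snd (diagonal_graph V)"
    then obtain x y x' y' where e: "e = {(x, y), (x', y')}" and V: "(x, y) \<in> V" "(x', y') \<in> V"
      and adj: "\<bar>x - x'\<bar> = 1" "\<bar>y - y'\<bar> = 1"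
      by (auto simp: diagonal_graph_def cell_adjacent_def)
    have *: "\<exists>z\<in>C. {(x, y), (x', y')} \<in> cell_edges z"
      if "(x, y) \<in> V" "(x', y') \<in> V" "even x" "\<bar>x - x'\<bar> = 1" "\<bar>y - y'\<bar> = 1" for x y x' y'
    proof -
      have z: "(x', y) \<in> C"
        using that by (rule assms)
      have "\<bar>x' - x\<bar> = 1"
        using that by linarith
      then have "{(x, y), (x', y')} \<in> cell_edges (x', y)"
        using that(5) unfolding cell_edges_iff by blast
      with z show ?thesis by blast
    qed
    have "\<exists>z\<in>C. e \<in> cell_edges z"
    \<comment> \<open>Adjacent cells lie in rows of opposite parity, so up to swapping the ends the
      first one is in an even row.\<close>
    proof (cases "even x")
      case True
      then show ?thesis unfolding e using *[OF V _ adj] by blast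
    next
      case False
      then have "even x'" using adj(1) by presburger
      then show ?thesis
        using *[OF V(2,1)] adj unfolding e by (simp add: insert_commute abs_minus_commute)
    qed
    then show "e \<in> (\<Union>z\<in>C. cell_edges z) \<and> e \<subseteq> V"
      using e V by auto
  next
    assume e: "e \<in> (\<Union>z\<in>C. cell_edges z) \<and> e \<subseteq> V"
    then obtain x y where z: "(x, y) \<in> C" "e \<in> cell_edges (x, y)"
      by auto
    obtain x' y' where "e = {(x', y), (x, y')}" "\<bar>x - x'\<bar> = 1" "\<bar>y - y'\<bar> = 1"
      using z(2) cell_edges_iff by blast
    then show "e \<in> snd (diagonal_graph V)"
      using e unfolding diagonal_graph_def cell_adjacent_def
      by (auto intro!: exI simp: abs_minus_commute)
  qed
  then show ?thesis
    unfolding diagonal_graph_def by auto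
qed

text \<open>Being a corner is a symmetric relation, so only the four neighbours of
  \<open>(x, y)\<close> can be centers of 4-cycles through it.\<close>

lemma card_cell_corners:
  "card {z \<in> C. (x, y) \<in> cell_corners z} =
    of_bool ((x + 1, y) \<in> C) + of_bool ((x, y - 1) \<in> C) + of_bool ((x - 1, y) \<in> C) + of_bool ((x, y + 1) \<in> C)"
proof -
  let ?N = "{(x + 1, y), (x, y - 1), (x - 1, y), (x, y + 1)}"
  have "{z \<in> C. (x, y) \<in> cell_corners z} = ?N \<inter> {z. z \<in> C}"
    by (auto simp: cell_corners_def)
  then have "card {z \<in> C. (x, y) \<in> cell_corners z} = (\<Sum>z\<in>?N. of_bool (z \<in> C))"
    by (subst sum_of_bool_eq) simp_all
  then show ?thesis by simp
qed

section \<open>Boards with rectangular holes\<close>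

lemma card_parity_even_ends:
  fixes p q :: int
  shows "card {x \<in> {2 * p..2 * q}. even x} = nat (q - p + 1)"
    and "card {x \<in> {2 * p..2 * q}. odd x} = nat (q - p)"
proof -
  have "{x \<in> {2 * p..2 * q}. even x} = (\<lambda>i. 2 * i) ` {p..q}"
    by (auto elim!: evenE)
  then show "card {x \<in> {2 * p..2 * q}. even x} = nat (q - p + 1)"
    by (simp add: card_image inj_on_def algebra_simps)
  have "{x \<in> {2 * p..2 * q}. odd x} = (\<lambda>i. 2 * i + 1) ` {p..q - 1}"
    by (auto elim!: oddE)
  then show "card {x \<in> {2 * p..2 * q}. odd x} = nat (q - p)"
    by (simp add: card_image inj_on_def)
qed

lemma card_parity_odd_ends:
  fixes p q :: int
  shows "card {x \<in> {2 * p - 1..2 * q - 1}. odd x} = nat (q - p + 1)"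
    and "card {x \<in> {2 * p - 1..2 * q - 1}. even x} = nat (q - p)"
proof -
  have "{x \<in> {2 * p - 1..2 * q - 1}. odd x} = (\<lambda>i. 2 * i + 1) ` {p - 1..q - 1}"
    by (auto elim!: oddE)
  then show "card {x \<in> {2 * p - 1..2 * q - 1}. odd x} = nat (q - p + 1)"
    by (simp add: card_image inj_on_def algebra_simps)
  have "{x \<in> {2 * p - 1..2 * q - 1}. even x} = (\<lambda>i. 2 * i) ` {p..q - 1}"
    by (auto elim!: evenE)
  then show "card {x \<in> {2 * p - 1..2 * q - 1}. even x} = nat (q - p)"
    by (simp add: card_image inj_on_def)
qed

lemma card_white_Times:
  assumes "finite A" "finite B"
  shows "card {p \<in> A \<times> B. white p} =
    card {x \<in> A. even x} * card {y \<in> B. odd y} + card {x \<in> A. odd x} * card {y \<in> B. even y}"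
proof -
  have "{p \<in> A \<times> B. white p} =
      {x \<in> A. even x} \<times> {y \<in> B. odd y} \<union> {x \<in> A. odd x} \<times> {y \<in> B. even y}"
    by (auto simp: white_def)
  moreover have "card \<dots> = card ({x \<in> A. even x} \<times> {y \<in> B. odd y}) + card ({x \<in> A. odd x} \<times> {y \<in> B. even y})"
    using assms by (intro card_Un_disjoint) auto
  ultimately show ?thesis
    by (simp add: card_cartesian_product)
qed

lemma card_odd_cells_Times:
  "card {p \<in> A \<times> B. p \<in> odd_cells} = card {x \<in> A. odd x} * card {y \<in> B. odd y}"
proof -
  have "{p \<in> A \<times> B. p \<in> odd_cells} = {x \<in> A. odd x} \<times> {y \<in> B. odd y}"
    by (auto simp: odd_cells_def)
  then show ?thesis
    by (simp add: card_cartesian_product)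
qed

text \<open>The disjunction and the conjunction of two statements determine how many of them
  hold.\<close>

lemma of_bool_add_eqI:
  assumes "P \<or> Q \<longleftrightarrow> R \<or> S" "P \<and> Q \<longleftrightarrow> R \<and> S"
  shows "of_bool P + of_bool Q = (of_bool R + of_bool S :: nat)"
  using assms by (cases P; cases Q; cases R; cases S) simp_all

lemma finite_board: "finite (board M N)"
  by (simp add: board_def)

text \<open>The paper's \<open>A\<^sub>i\<close> is \<open>{l i..l i + a i}\<close>.\<close>

locale hole_intervals =
  fixes m n :: nat and I :: "'i set" and l :: "'i \<Rightarrow> int" and a :: "'i \<Rightarrow> nat"
  assumes m_pos: "m > 0" and m_even: "even m" and finite_I: "finite I"
    and n_eq: "n = m + (\<Sum>i\<in>I. a i + 1)"
    and l_pos: "i \<in> I \<Longrightarrow> 1 \<le> l i" and u_le: "i \<in> I \<Longrightarrow> l i + int (a i) \<le> int n"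
    and disj: "disjoint_family_on (\<lambda>i. {l i..l i + int (a i)}) I"
begin

section \<open>Holes and cell counts\<close>

text \<open>The full rectangle spanned by the deleted odd Aztec rectangle, black cells included, so
  that it removes vertices and centers of 4-cycles alike.\<close>

definition hole :: "nat \<Rightarrow> 'i \<Rightarrow> cell set" where
  "hole k i = {int m..int m + 2 * int k} \<times> {2 * (l i + int k) - 1..2 * (l i + int (a i)) - 1}"

definition holed_board :: "nat \<Rightarrow> cell set" where
  "holed_board k = board (m + k) (n + k) - (\<Union>i\<in>I. hole k i)"

definition holed_whites :: "nat \<Rightarrow> cell set" where
  "holed_whites k = {p \<in> holed_board k. white p}"

definition holed_cells :: "nat \<Rightarrow> cell set" where
  "holed_cells k = {p \<in> holed_board k. p \<in> odd_cells}"

lemma aztec_rectangle_vertices_minus_holes: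
  "aztec_rectangle_vertices (m + k) (n + k) - (\<Union>i\<in>I. {p \<in> hole k i. white p}) = holed_whites k"
  by (auto simp: aztec_rectangle_vertices_def holed_whites_def holed_board_def)

lemma hole_subset_board:
  assumes "i \<in> I"
  shows "hole k i \<subseteq> board (m + k) (n + k)"
  using l_pos[OF assms] u_le[OF assms] by (auto simp: hole_def board_def)

text \<open>If column \<open>y\<close> meets the hole of \<open>i\<close>, then
  \<open>(y + 1) div 2\<close> lies in \<open>{l i..l i + a i}\<close>, and these intervals are
  disjoint.\<close>

lemma disjoint_holes:
  assumes "i \<in> I" "j \<in> I" "i \<noteq> j"
  shows "hole k i \<inter> hole k j = {}"
proof (rule ccontr)
  assume "hole k i \<inter> hole k j \<noteq> {}"
  then obtain y where y: "2 * (l i + int k) - 1 \<le> y" "y \<le> 2 * (l i + int (a i)) - 1"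
    "2 * (l j + int k) - 1 \<le> y" "y \<le> 2 * (l j + int (a j)) - 1"
    by (auto simp: hole_def)
  have "(y + 1) div 2 \<in> {l i..l i + int (a i)} \<inter> {l j..l j + int (a j)}"
    using y by auto
  then show False
    using disj assms unfolding disjoint_family_on_def by blast
qed

lemma card_holed_board:
  "card {p \<in> holed_board k. P p} + (\<Sum>i\<in>I. card {p \<in> hole k i. P p}) =
    card {p \<in> board (m + k) (n + k). P p}"
proof -
  let ?B = "{p \<in> board (m + k) (n + k). P p}"
  let ?H = "\<Union>i\<in>I. {p \<in> hole k i. P p}"
  have fin: "finite (hole k i)" for i
    by (simp add: hole_def)
  have H: "?H \<subseteq> ?B"
    using hole_subset_board by blast
  have "{p \<in> holed_board k. P p} = ?B - ?H"
    by (auto simp: holed_board_def)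
  moreover have "card ?H = (\<Sum>i\<in>I. card {p \<in> hole k i. P p})"
    using finite_I fin disjoint_holes by (intro card_UN_disjoint) (auto, blast)
  moreover have "card (?B - ?H) + card ?H = card ?B"
    using H finite_board[of "m + k" "n + k"]
    by (simp add: card_Diff_subset card_mono finite_subset)
  ultimately show ?thesis by simp
qed

text \<open>This computes the exponent of 2 in one step: half the number of vertices minus the
  number of 4-cycles.\<close>

lemma card_holed_whites:
  assumes "\<And>i. i \<in> I \<Longrightarrow> k \<le> a i"
  shows "card (holed_whites k) = 2 * (card (holed_cells k) + m + k * (card I + 1))"
proof -
  \<comment> \<open>Since \<open>m\<close> is even, every hole begins and ends in an even row, while
    its first and last columns are odd.\<close>
  obtain h where h: "int m = 2 * h"
    using m_even by (metis dvd_def of_nat_mult of_nat_numeral)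
  define L where "L i = a i - k" for i
  define \<sigma> where "\<sigma> = (\<Sum>i\<in>I. L i)"
  have hole: "hole k i = {2 * h..2 * (h + int k)} \<times> {2 * (l i + int k) - 1..2 * (l i + int (a i)) - 1}" for i
    by (simp add: hole_def h)
  have board: "board (m + k) (n + k) = {2 * 0..2 * int (m + k)} \<times> {2 * 0..2 * int (n + k)}"
    by (simp add: board_def)
  have nat_L: "nat (l i + int (a i) - (l i + int k) + 1) = L i + 1"
    "nat (l i + int (a i) - (l i + int k)) = L i" if "i \<in> I" for i
    using assms[OF that] by (simp_all add: L_def)
  have nat_k: "nat (h + int k - h + 1) = k + 1" "nat (int j - 0 + 1) = j + 1" "nat (int j - 0) = j" for j
    by simp_all
  have "card {p \<in> hole k i. white p} = (k + 1) * (L i + 1) + k * L i" if "i \<in> I" for i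
    unfolding hole card_white_Times[OF finite_atLeastAtMost_int finite_atLeastAtMost_int]
      card_parity_even_ends card_parity_odd_ends nat_k nat_L[OF that] by simp
  then have "(\<Sum>i\<in>I. card {p \<in> hole k i. white p}) = (\<Sum>i\<in>I. (2 * k + 1) * L i + (k + 1))"
    by (intro sum.cong) (auto simp: algebra_simps)
  also have "\<dots> = (2 * k + 1) * \<sigma> + (k + 1) * card I"
    unfolding sum.distrib sum_distrib_left[symmetric] \<sigma>_def by simp
  finally have "card (holed_whites k) + ((2 * k + 1) * \<sigma> + (k + 1) * card I) =
      (m + k + 1) * (n + k) + (m + k) * (n + k + 1)"
    using card_holed_board[of k white]
    unfolding board card_white_Times[OF finite_atLeastAtMost_int finite_atLeastAtMost_int]
      card_parity_even_ends nat_k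
    by (simp only: holed_whites_def)
  note whites = this
  have "card {p \<in> hole k i. p \<in> odd_cells} = k * (L i + 1)" if "i \<in> I" for i
    unfolding hole card_odd_cells_Times card_parity_even_ends card_parity_odd_ends nat_L[OF that]
    by simp
  then have "(\<Sum>i\<in>I. card {p \<in> hole k i. p \<in> odd_cells}) = (\<Sum>i\<in>I. k * L i + k)"
    by (intro sum.cong) (auto simp: algebra_simps)
  also have "\<dots> = k * \<sigma> + k * card I"
    unfolding sum.distrib sum_distrib_left[symmetric] \<sigma>_def by simp
  finally have "card (holed_cells k) + (k * \<sigma> + k * card I) = (m + k) * (n + k)"
    using card_holed_board[of k "\<lambda>p. p \<in> odd_cells"]
    unfolding board card_odd_cells_Times card_parity_even_ends nat_k
    by (simp only: holed_cells_def)
  moreover note whites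
  \<comment> \<open>The number of vertices exceeds twice the number of centers by
    \<open>n + m + 2 * k + k * card I - card I - \<sigma>\<close>; eliminating \<open>n\<close> also
    removes \<open>\<sigma>\<close>.\<close>
  moreover have "n = m + (\<sigma> + (k + 1) * card I)"
  proof -
    have "(\<Sum>i\<in>I. a i + 1) = (\<Sum>i\<in>I. L i + (k + 1))"
      using assms by (intro sum.cong) (auto simp: L_def)
    also have "\<dots> = \<sigma> + (k + 1) * card I"
      unfolding sum.distrib \<sigma>_def by simp
    finally show ?thesis
      by (simp only: n_eq)
  qed
  ultimately show ?thesis
    by (simp add: algebra_simps)
qed

section \<open>Columns of holes and the degree count\<close>

text \<open>All holes occupy the same rows, so membership in their union separates into a row
  condition and this column condition.\<close>

definition in_hole_columns :: "nat \<Rightarrow> int \<Rightarrow> bool" where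
  "in_hole_columns k y \<longleftrightarrow> (\<exists>i\<in>I. 2 * (l i + int k) - 1 \<le> y \<and> y \<le> 2 * (l i + int (a i)) - 1)"

lemma holed_board_iff:
  "(x, y) \<in> holed_board k \<longleftrightarrow> 0 \<le> x \<and> x \<le> 2 * (int m + int k) \<and> 0 \<le> y \<and> y \<le> 2 * (int n + int k) \<and>
    \<not> (int m \<le> x \<and> x \<le> int m + 2 * int k \<and> in_hole_columns k y)"
  by (auto simp: holed_board_def board_def hole_def in_hole_columns_def)

text \<open>Moved right by one, the hole for \<open>k\<close> spans columns
  \<open>2 * (l i + k)\<close> to \<open>2 * (l i + a i)\<close>: one more on each side than for
  \<open>Suc k\<close>, and both extra columns are even.\<close>

lemma in_hole_columns_shift_odd:
  assumes "odd y"
  shows "in_hole_columns k (y - 1) \<longleftrightarrow> in_hole_columns (Suc k) y"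
proof -
  have "2 * p - 1 \<le> y - 1 \<longleftrightarrow> 2 * (p + 1) - 1 \<le> y" "y - 1 \<le> 2 * p - 1 \<longleftrightarrow> y \<le> 2 * p - 1" for p
    using assms by presburger+
  then show ?thesis
    by (simp only: in_hole_columns_def of_nat_Suc add.commute[of 1] add.assoc)
qed

text \<open>The extra end columns of the moved hole are next to the end columns of the hole for
  \<open>Suc k\<close>, which has a column because \<open>Suc k \<le> a i\<close>.\<close>

lemma in_hole_columns_shift_even:
  assumes "even y" "\<And>i. i \<in> I \<Longrightarrow> Suc k \<le> a i"
  shows "in_hole_columns k (y - 1) \<longleftrightarrow> in_hole_columns (Suc k) (y - 1) \<or> in_hole_columns (Suc k) (y + 1)"
proof -
  have "(2 * (l i + int k) - 1 \<le> y - 1 \<and> y - 1 \<le> 2 * (l i + int (a i)) - 1) \<longleftrightarrow>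
      (2 * (l i + int (Suc k)) - 1 \<le> y - 1 \<and> y - 1 \<le> 2 * (l i + int (a i)) - 1) \<or>
      (2 * (l i + int (Suc k)) - 1 \<le> y + 1 \<and> y + 1 \<le> 2 * (l i + int (a i)) - 1)" if "i \<in> I" for i
    using assms(1) assms(2)[OF that] by presburger
  then show ?thesis
    unfolding in_hole_columns_def by blast
qed

text \<open>Two different holes are separated by at least one odd column, so the neighbours \<open>y - 1\<close> and
  \<open>y + 1\<close> of an even column cannot lie in different holes.\<close>

lemma in_hole_columns_even:
  assumes "even y"
  shows "in_hole_columns (Suc k) y \<longleftrightarrow> in_hole_columns (Suc k) (y - 1) \<and> in_hole_columns (Suc k) (y + 1)"
proof
  assume "in_hole_columns (Suc k) y"
  then obtain i where "i \<in> I" "2 * (l i + int (Suc k)) - 1 \<le> y" "y \<le> 2 * (l i + int (a i)) - 1"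
    by (auto simp: in_hole_columns_def)
  moreover from this assms have "2 * (l i + int (Suc k)) - 1 \<le> y - 1" "y + 1 \<le> 2 * (l i + int (a i)) - 1"
    by presburger+
  ultimately show "in_hole_columns (Suc k) (y - 1) \<and> in_hole_columns (Suc k) (y + 1)"
    unfolding in_hole_columns_def by (smt (verit))
next
  assume "in_hole_columns (Suc k) (y - 1) \<and> in_hole_columns (Suc k) (y + 1)"
  then obtain i j where i: "i \<in> I" "2 * (l i + int (Suc k)) - 1 \<le> y - 1" "y - 1 \<le> 2 * (l i + int (a i)) - 1"
    and j: "j \<in> I" "2 * (l j + int (Suc k)) - 1 \<le> y + 1" "y + 1 \<le> 2 * (l j + int (a j)) - 1"
    by (auto simp: in_hole_columns_def)
  \<comment> \<open>Half of the even column lies in both intervals, which forces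
    \<open>i = j\<close>.\<close>
  have "y div 2 \<in> {l i..l i + int (a i)} \<inter> {l j..l j + int (a j)}"
    using i j by auto
  then have "i = j"
    using disj i(1) j(1) unfolding disjoint_family_on_def by blast
  then show "in_hole_columns (Suc k) y"
    using i j unfolding in_hole_columns_def by (smt (verit))
qed

lemma not_in_hole_columns:
  assumes "y < 2 * int k \<or> 2 * int n \<le> y"
  shows "\<not> in_hole_columns k y"
proof
  assume "in_hole_columns k y"
  then obtain i where "i \<in> I" "2 * (l i + int k) - 1 \<le> y" "y \<le> 2 * (l i + int (a i)) - 1"
    by (auto simp: in_hole_columns_def)
  then show False
    using assms l_pos[of i] u_le[of i] by auto
qed

text \<open>Moving by \<open>(1, 1)\<close> preserves colours and places the board for
  \<open>k\<close> inside the board for \<open>Suc k\<close> with a margin of one cell on every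
  side.\<close>

lemma mem_translate_holed_whites:
  "(x, y) \<in> (\<lambda>p. p + (1, 1)) ` holed_whites k \<longleftrightarrow> (x - 1, y - 1) \<in> holed_board k \<and> odd (x + y)"
proof -
  have "(x, y) \<in> (\<lambda>p. p + (1, 1)) ` holed_whites k \<longleftrightarrow> (x - 1, y - 1) \<in> holed_whites k"
    by (force simp: image_iff)
  then show ?thesis
    by (auto simp: holed_whites_def white_def)
qed

text \<open>A white cell has two neighbours with odd coordinates, above and below it in an odd
  column, left and right of it in an even one. A black cell has none, which settles the cases of
  equal parity.\<close>

lemma degree_holed_cells:
  assumes "\<And>i. i \<in> I \<Longrightarrow> Suc k \<le> a i"
  shows "card {z \<in> holed_cells (Suc k). v \<in> cell_corners z} =
    of_bool (v \<in> holed_whites (Suc k)) + of_bool (v \<in> (\<lambda>p. p + (1, 1)) ` holed_whites k)"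
proof -
  obtain x y where v: "v = (x, y)" by (cases v)
  have C: "(x', y') \<in> holed_cells (Suc k) \<longleftrightarrow> (x', y') \<in> holed_board (Suc k) \<and> odd x' \<and> odd y'" for x' y'
    by (auto simp: holed_cells_def odd_cells_def)
  have W: "(x, y) \<in> holed_whites (Suc k) \<longleftrightarrow> (x, y) \<in> holed_board (Suc k) \<and> odd (x + y)"
    by (auto simp: holed_whites_def white_def)
  obtain h where h: "int m = 2 * h"
    using m_even by (metis dvd_def of_nat_mult of_nat_numeral)
  have hpos: "h > 0"
    using m_pos h by simp
  have h': "int m + 2 * j = 2 * (h + j)" for j
    using h by simp
  \<comment> \<open>With \<open>x\<close> and \<open>y\<close> written through their halves, all
    bounds become bounds on \<open>x'\<close> and \<open>y'\<close>, and parity disappears from the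
    case analysis.\<close>
  have halve: "2 * p + 1 \<le> 2 * q \<longleftrightarrow> p < q" "2 * p - 1 \<le> 2 * q \<longleftrightarrow> p \<le> q" "2 * p \<le> 2 * q \<longleftrightarrow> p \<le> q"
    "2 * q \<le> 2 * p + 1 \<longleftrightarrow> q \<le> p" "2 * q \<le> 2 * p - 1 \<longleftrightarrow> q < p"
    "0 \<le> 2 * p + 1 \<longleftrightarrow> 0 \<le> p" "0 \<le> 2 * p - 1 \<longleftrightarrow> 0 < p" "0 \<le> 2 * p \<longleftrightarrow> 0 \<le> p" for p q :: int
    by presburger+
  consider "even x" "even y" | "odd x" "odd y" | "even x" "odd y" | "odd x" "even y"
    by blast
  then show ?thesis
  proof cases
    case 3
    then obtain x' y' where xy: "x = 2 * x'" "y = 2 * y' + 1"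
      by (meson evenE oddE)
    \<comment> \<open>In an odd column the holes for \<open>Suc k\<close> and the moved holes for
      \<open>k\<close> agree, so one flag serves all four memberships; only the row ranges
      differ.\<close>
    define b where "b = in_hole_columns (Suc k) y"
    have e1: "(x - 1, y - 1) \<in> holed_board k \<longleftrightarrow> 0 < x' \<and> x' \<le> 2 * h + int k \<and> 0 \<le> y' \<and> y' \<le> int n + int k \<and>
        \<not> (h < x' \<and> x' \<le> h + int k \<and> b)"
      unfolding holed_board_iff h' in_hole_columns_shift_odd[OF 3(2)] b_def
      unfolding h xy by (simp only: halve add_diff_cancel_right')
    have e2: "(x, y) \<in> holed_board (Suc k) \<longleftrightarrow> 0 \<le> x' \<and> x' \<le> 2 * h + int (Suc k) \<and> 0 \<le> y' \<and> y' < int n + int (Suc k) \<and>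
        \<not> (h \<le> x' \<and> x' \<le> h + int (Suc k) \<and> b)"
      unfolding holed_board_iff h' b_def unfolding h xy by (simp only: halve)
    have e3: "(x + 1, y) \<in> holed_board (Suc k) \<longleftrightarrow> 0 \<le> x' \<and> x' < 2 * h + int (Suc k) \<and> 0 \<le> y' \<and> y' < int n + int (Suc k) \<and>
        \<not> (h \<le> x' \<and> x' < h + int (Suc k) \<and> b)"
      unfolding holed_board_iff h' b_def unfolding h xy by (simp only: halve)
    have e4: "(x - 1, y) \<in> holed_board (Suc k) \<longleftrightarrow> 0 < x' \<and> x' \<le> 2 * h + int (Suc k) \<and> 0 \<le> y' \<and> y' < int n + int (Suc k) \<and>
        \<not> (h < x' \<and> x' \<le> h + int (Suc k) \<and> b)"
      unfolding holed_board_iff h' b_def unfolding h xy by (simp only: halve)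
    have "of_bool ((x + 1, y) \<in> holed_board (Suc k)) + of_bool ((x - 1, y) \<in> holed_board (Suc k)) =
      (of_bool ((x, y) \<in> holed_board (Suc k)) + of_bool ((x - 1, y - 1) \<in> holed_board k) :: nat)"
      unfolding e1 e2 e3 e4 by (intro of_bool_add_eqI) (use hpos in \<open>smt (verit) of_nat_Suc of_nat_0_le_iff\<close>)+
    then show ?thesis
      using 3 unfolding v card_cell_corners C W mem_translate_holed_whites by simp
  next
    case 4
    then obtain x' y' where xy: "x = 2 * x' + 1" "y = 2 * y'"
      by (meson evenE oddE)
    \<comment> \<open>An even column meets a hole for \<open>Suc k\<close> iff both flags hold, and
      a moved hole for \<open>k\<close> iff at least one does, which matches the two centers at
      \<open>y - 1\<close> and \<open>y + 1\<close>.\<close>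
    define b c where "b = in_hole_columns (Suc k) (y - 1)" and "c = in_hole_columns (Suc k) (y + 1)"
    \<comment> \<open>At the left and right boundary, where only one of the two centers can be on
      the board, the column of that center is free of holes.\<close>
    have c: "\<not> c" if "y' \<le> 0"
      unfolding c_def using that xy by (intro not_in_hole_columns) auto
    have b: "\<not> b" if "int n + int (Suc k) \<le> y'"
      unfolding b_def using that xy by (intro not_in_hole_columns) auto
    have shift: "in_hole_columns k (y - 1) \<longleftrightarrow> b \<or> c"
      unfolding b_def c_def using 4(2) by (rule in_hole_columns_shift_even) (rule assms)
    have e1: "(x - 1, y - 1) \<in> holed_board k \<longleftrightarrow> 0 \<le> x' \<and> x' \<le> 2 * h + int k \<and> 0 < y' \<and> y' \<le> int n + int k \<and>
        \<not> (h \<le> x' \<and> x' \<le> h + int k \<and> (b \<or> c))"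
      unfolding holed_board_iff h' shift
      unfolding h xy by (simp only: halve add_diff_cancel_right')
    have e2: "(x, y) \<in> holed_board (Suc k) \<longleftrightarrow> 0 \<le> x' \<and> x' < 2 * h + int (Suc k) \<and> 0 \<le> y' \<and> y' \<le> int n + int (Suc k) \<and>
        \<not> (h \<le> x' \<and> x' < h + int (Suc k) \<and> b \<and> c)"
      unfolding holed_board_iff h' in_hole_columns_even[OF 4(2)] b_def c_def unfolding h xy by (simp only: halve)
    have e3: "(x, y - 1) \<in> holed_board (Suc k) \<longleftrightarrow> 0 \<le> x' \<and> x' < 2 * h + int (Suc k) \<and> 0 < y' \<and> y' \<le> int n + int (Suc k) \<and>
        \<not> (h \<le> x' \<and> x' < h + int (Suc k) \<and> b)"
      unfolding holed_board_iff h' b_def unfolding h xy by (simp only: halve)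
    have e4: "(x, y + 1) \<in> holed_board (Suc k) \<longleftrightarrow> 0 \<le> x' \<and> x' < 2 * h + int (Suc k) \<and> 0 \<le> y' \<and> y' < int n + int (Suc k) \<and>
        \<not> (h \<le> x' \<and> x' < h + int (Suc k) \<and> c)"
      unfolding holed_board_iff h' c_def unfolding h xy by (simp only: halve)
    have "of_bool ((x, y - 1) \<in> holed_board (Suc k)) + of_bool ((x, y + 1) \<in> holed_board (Suc k)) =
      (of_bool ((x, y) \<in> holed_board (Suc k)) + of_bool ((x - 1, y - 1) \<in> holed_board k) :: nat)"
      unfolding e1 e2 e3 e4 by (intro of_bool_add_eqI) (use b c in \<open>smt (verit) of_nat_Suc of_nat_0_le_iff\<close>)+
    then show ?thesis
      using 4 unfolding v card_cell_corners C W mem_translate_holed_whites by simp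
  qed (simp_all add: v card_cell_corners C W mem_translate_holed_whites)
qed

section \<open>One complementation step and its iteration\<close>

lemma num_perfect_matchings_holed_whites_step:
  assumes "\<And>i. i \<in> I \<Longrightarrow> Suc k \<le> a i"
  shows "num_perfect_matchings (diagonal_graph (holed_whites (Suc k))) =
    2 ^ (m + Suc k * (card I + 1)) * num_perfect_matchings (diagonal_graph (holed_whites k))"
proof -
  let ?C = "holed_cells (Suc k)"
  let ?V = "holed_whites (Suc k)"
  let ?V' = "(\<lambda>p. p + (1, 1)) ` holed_whites k"
  have C: "?C \<subseteq> odd_cells"
    by (auto simp: holed_cells_def)
  have fin: "finite ?C"
    using finite_board by (auto simp: holed_cells_def holed_board_def)
  obtain h where h: "int m = 2 * h"
    using m_even by (metis dvd_def of_nat_mult of_nat_numeral)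
  have G: "diagonal_graph ?V = (?V, {e \<in> (\<Union>z\<in>?C. cell_edges z). e \<subseteq> ?V})"
  proof (rule diagonal_graph_eq_cell_edges)
    fix x y x' y' :: int
    assume V: "(x, y) \<in> ?V" "(x', y') \<in> ?V" "even x" "\<bar>x - x'\<bar> = 1" "\<bar>y - y'\<bar> = 1"
    then have xy: "odd x'" "odd y" "(x, y) \<in> holed_board (Suc k)" "(x', y') \<in> holed_board (Suc k)"
      by (auto simp: holed_whites_def white_def) presburger
    \<comment> \<open>The first and last rows of a hole are even, so with an odd row
      \<open>x'\<close> it contains the adjacent row \<open>x\<close>. A center
      \<open>(x', y)\<close> in a hole would thus put the vertex \<open>(x, y)\<close>
      there.\<close>
    moreover have "int m \<le> x \<and> x \<le> int m + 2 * int (Suc k)"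
      if "int m \<le> x' \<and> x' \<le> int m + 2 * int (Suc k)"
      using that V(3,4) xy(1) h by presburger
    ultimately show "(x', y) \<in> ?C"
      by (auto simp: holed_board_iff holed_cells_def odd_cells_def)
  qed
  have G': "diagonal_graph ?V' = (?V', {e \<in> (\<Union>z\<in>?C. cell_edges z). e \<subseteq> ?V'})"
  proof (rule diagonal_graph_eq_cell_edges)
    fix x y x' y' :: int
    assume V: "(x, y) \<in> ?V'" "(x', y') \<in> ?V'" "even x" "\<bar>x - x'\<bar> = 1" "\<bar>y - y'\<bar> = 1"
    then have par: "odd (x + y)" "odd (x' + y')"
      and xy: "(x - 1, y - 1) \<in> holed_board k" "(x' - 1, y' - 1) \<in> holed_board k"
      unfolding mem_translate_holed_whites by blast+
    have odd: "odd x'" "odd y" "even y'"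
      using V(3-5) par by presburger+
    have y: "y = y' - 1 \<or> y = y' + 1"
      using V(5) by linarith
    \<comment> \<open>A center in a hole for \<open>Suc k\<close> would put the vertex
      \<open>(x', y')\<close> into a moved hole for \<open>k\<close>, as \<open>y'\<close> is an
      even column next to \<open>y\<close>.\<close>
    have "\<not> (int m \<le> x' \<and> x' \<le> int m + 2 * int (Suc k) \<and> in_hole_columns (Suc k) y)"
    proof
      assume A: "int m \<le> x' \<and> x' \<le> int m + 2 * int (Suc k) \<and> in_hole_columns (Suc k) y"
      then have "in_hole_columns k (y' - 1)"
        using y in_hole_columns_shift_even[OF odd(3) assms] by auto
      moreover have "int m \<le> x' - 1 \<and> x' - 1 \<le> int m + 2 * int k"
      proof -
        have "int m \<le> x'" "x' \<le> int m + 2 * int (Suc k)"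
          using A by blast+
        then show ?thesis
          using odd(1) h by presburger
      qed
      ultimately show False
        using xy(2) unfolding holed_board_iff by blast
    qed
    moreover have "0 \<le> x' \<and> x' \<le> 2 * (int m + int (Suc k)) \<and> 0 \<le> y \<and> y \<le> 2 * (int n + int (Suc k))"
      using xy unfolding holed_board_iff by auto
    ultimately show "(x', y) \<in> ?C"
      using odd(1,2) by (auto simp: holed_board_iff holed_cells_def odd_cells_def)
  qed
  have "2 ^ card ?C * num_perfect_matchings (diagonal_graph ?V) =
      2 ^ (card ?V div 2) * num_perfect_matchings (diagonal_graph ?V')"
    unfolding G G' num_perfect_matchings_eq_card_matchings_covering
    by (rule complementation[OF fin four_cycle_cell disjoint_family_on_cell_edges[OF C]
          degree_holed_cells[OF assms]])
  moreover have "card ?V div 2 = card ?C + (m + Suc k * (card I + 1))"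
    using card_holed_whites[of "Suc k"] assms by simp
  ultimately have "2 ^ card ?C * num_perfect_matchings (diagonal_graph ?V) =
      2 ^ card ?C * (2 ^ (m + Suc k * (card I + 1)) * num_perfect_matchings (diagonal_graph (holed_whites k)))"
    by (simp only: num_perfect_matchings_translate power_add mult.assoc)
  then show ?thesis
    by (simp only: mult_cancel1) simp
qed

text \<open>The exponents \<open>m + j * (card I + 1)\<close> for \<open>j\<close> from 1 to
  \<open>k\<close> are added up.\<close>

lemma num_perfect_matchings_holed_whites:
  assumes "\<And>i. i \<in> I \<Longrightarrow> k \<le> a i"
  shows "num_perfect_matchings (diagonal_graph (holed_whites k)) =
    2 ^ (((k + 1) choose 2) * (card I + 1) + k * m) * num_perfect_matchings (diagonal_graph (holed_whites 0))"
  using assms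
proof (induction k)
  case (Suc k)
  have "((Suc k + 1) choose 2) = ((k + 1) choose 2) + Suc k"
    by (simp add: numeral_2_eq_2)
  then have "((Suc k + 1) choose 2) * (card I + 1) + Suc k * m =
      (m + Suc k * (card I + 1)) + (((k + 1) choose 2) * (card I + 1) + k * m)"
    by (simp add: algebra_simps)
  moreover have "\<And>i. i \<in> I \<Longrightarrow> k \<le> a i"
    using Suc.prems Suc_leD by blast
  ultimately show ?case
    using num_perfect_matchings_holed_whites_step[OF Suc.prems] Suc.IH
    by (simp only: power_add mult.assoc)
qed (simp add: numeral_2_eq_2)

end

section \<open>Identification with the graphs of the theorem\<close>

text \<open>Here \<open>2 * l + a\<close> is twice the center of the interval. As \<open>m\<close>
  is even and \<open>k + (a - k) = a\<close>, the parity condition on \<open>r + t\<close> says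
  exactly that the cell is white.\<close>

lemma odd_aztec_rectangle_eq:
  assumes "even m" "k \<le> a"
  shows "odd_aztec_rectangle k (a - k) (int m + int k, int k + (2 * l + int a) - 1) =
    {p \<in> {int m..int m + 2 * int k} \<times> {2 * (l + int k) - 1..2 * (l + int a) - 1}. white p}"
    (is "?A = ?B")
proof (intro set_eqI iffI)
  fix p assume "p \<in> ?A"
  then obtain r t where p: "p = (int m + int k + r, int k + (2 * l + int a) - 1 + t)"
    and r: "\<bar>r\<bar> \<le> int k" and t: "\<bar>t\<bar> \<le> int (a - k)"
    and par: "(r + t) mod 2 = (int k + int (a - k)) mod 2"
    by (auto simp: odd_aztec_rectangle_def)
  have "odd ((int m + int k + r) + (int k + (2 * l + int a) - 1 + t))"
    using par assms by presburger
  then show "p \<in> ?B"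
    using r t assms(2) by (auto simp: p white_def of_nat_diff)
next
  fix p assume "p \<in> ?B"
  then obtain x y where p: "p = (x, y)" and x: "int m \<le> x" "x \<le> int m + 2 * int k"
    and y: "2 * (l + int k) - 1 \<le> y" "y \<le> 2 * (l + int a) - 1" and w: "odd (x + y)"
    by (auto simp: white_def)
  define r t where "r = x - (int m + int k)" and "t = y - (int k + (2 * l + int a) - 1)"
  have "(r + t) mod 2 = (int k + int (a - k)) mod 2"
    using w assms unfolding r_def t_def by presburger
  moreover have "\<bar>r\<bar> \<le> int k" "\<bar>t\<bar> \<le> int (a - k)"
    using x y assms(2) by (auto simp: r_def t_def of_nat_diff)
  moreover have "p = (int m + int k + r, int k + (2 * l + int a) - 1 + t)"
    by (simp add: p r_def t_def)
  ultimately show "p \<in> ?A"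
    unfolding odd_aztec_rectangle_def by auto
qed

theorem theorem3p1:
  fixes m s k :: nat and a :: "nat \<Rightarrow> nat" and c :: "nat \<Rightarrow> real"
  assumes "m > 0" and "even m" and "s \<ge> 1"
    and "\<forall>i\<in>{1..s}. 2 * c i \<in> \<int> \<and> c i - real (a i) / 2 \<in> \<int>"
    and "disjoint_family_on (\<lambda>i. centered_interval (c i) (a i)) {1..s}"
    and "\<forall>i\<in>{1..s}. centered_interval (c i) (a i) \<subseteq> {1..int (m + (\<Sum>i=1..s. (a i + 1)))}"
    and "1 \<le> k" and "k \<le> Min (a ` {1..s})"
  shows "num_perfect_matchings (holey_aztec_rectangle m s a c k) =
           2 ^ (((k + 1) choose 2) * (s + 1) + k * m) *
           num_perfect_matchings (holey_aztec_rectangle m s a c 0)"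
proof -
  let ?n = "m + (\<Sum>i=1..s. (a i + 1))"
  \<comment> \<open>The least element of the \<open>i\<close>-th interval; the number is an integer
    by assumption, so the floor only changes its type.\<close>
  define l where "l i = \<lfloor>c i - real (a i) / 2\<rfloor>" for i
  have c: "c i = real_of_int (l i) + real (a i) / 2" if "i \<in> {1..s}" for i
    using assms(4) that by (auto simp: l_def elim!: Ints_cases)
  have floor: "\<lfloor>2 * c i\<rfloor> = 2 * l i + int (a i)" if "i \<in> {1..s}" for i
  proof -
    have "2 * c i = real_of_int (2 * l i + int (a i))"
      using c[OF that] by simp
    then show ?thesis by linarith
  qed
  have interval: "centered_interval (c i) (a i) = {l i..l i + int (a i)}" if "i \<in> {1..s}" for i
    unfolding centered_interval_def c[OF that] by auto
  interpret hole_intervals m ?n "{1..s}" l a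
  proof
    fix i assume i: "i \<in> {1..s}"
    have "{l i..l i + int (a i)} \<subseteq> {1..int ?n}"
      using assms(6) interval[OF i] i by blast
    then show "1 \<le> l i" "l i + int (a i) \<le> int ?n"
      by (simp_all only: atLeastatMost_subset_iff) auto
  next
    show "disjoint_family_on (\<lambda>i. {l i..l i + int (a i)}) {1..s}"
      using assms(5) interval by (simp add: disjoint_family_on_def)
  qed (use assms in auto)
  have eq: "holey_aztec_rectangle m s a c j = diagonal_graph (holed_whites j)" if "j \<le> k" for j
  proof -
    \<comment> \<open>This makes the natural number subtraction \<open>a i - j\<close>
      exact.\<close>
    have "j \<le> a i" if "i \<in> {1..s}" for i
      using \<open>j \<le> k\<close> assms(8) that by (meson Min_le finite_atLeastAtMost finite_imageI imageI order_trans)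
    then have "(\<Union>i\<in>{1..s}. odd_aztec_rectangle j (a i - j) (int m + int j, int j + \<lfloor>2 * c i\<rfloor> - 1)) =
        (\<Union>i\<in>{1..s}. {p \<in> hole j i. white p})"
      by (intro SUP_cong refl) (simp only: hole_def floor odd_aztec_rectangle_eq[OF assms(2)])
    moreover have "m + j + (\<Sum>i=1..s. (a i + 1)) = ?n + j"
      by simp
    ultimately show ?thesis
      unfolding holey_aztec_rectangle_def delete_vertices_aztec_rectangle
      by (simp only: aztec_rectangle_vertices_minus_holes)
  qed
  have "k \<le> a i" if "i \<in> {1..s}" for i
    using assms(8) that by (meson Min_le finite_atLeastAtMost finite_imageI imageI order_trans)
  then show ?thesis
    using num_perfect_matchings_holed_whites[of k] eq[of k] eq[of 0] by simp
qed

end
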